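(* Let $(Q,\sigma)$ be a proper cyclically ordered quiver such that $Q$ is complete, and let $b$ be a vertex of $Q$. If the (properly) mutated cyclically ordered quiver $Q'=\mu_b(Q,\sigma)$ is vortex-free, then $Q'$ is proper.
   Context: A quiver is a finite directed graph without loops or oriented 2-cycles; multiple arrows are allowed. A quiver is complete if each pair of its vertices is connected by at least one arrow (in one of the two directions). A vortex is a complete 4-vertex quiver such that one of its vertices is a source or a sink, and the remaining three vertices support an oriented 3-cycle. A quiver (or cyclically ordered quiver) is vortex-free if none of its full (induced) 4-vertex subquivers is a vortex. Mutation $\mu_j$ of a quiver at a vertex $j$: for each path $i\to j\to k$ add an arrow $i\to k$; reverse all arrows incident to $j$; repeatedly remove oriented 2-cycles. A cyclic ordering $\sigma=(v_1,\dots,v_n)$ of the vertex set is a linear ordering considered up to cyclic shifts ("clockwise" placement on a circle). A cyclically ordered quiver (COQ) $(Q,\sigma)$ is a quiver with a cyclic ordering of its vertices. A wiggle transforms $(Q,\sigma)$ into $(Q,\sigma')$ where $\sigma'$ is obtained from $\sigma$ by interchanging two vertices that are consecutive in $\sigma$ and not adjacent in $Q$. Wiggle equivalence is the equivalence relation generated by wiggles. (A complete COQ allows no wiggles.) A path $i\to j\to k$ in $Q$ makes a right turn at $j$ if $\sigma=(\dots,i,\dots,j,\dots,k,\dots)$. A vertex $j$ is proper in $(Q,\sigma)$ if every oriented two-arrow path $i\to j\to k$ in $Q$ makes a right turn at $j$. A COQ $(Q,\sigma)$ is proper if for every vertex $j$ there is a COQ wiggle equivalent to $(Q,\sigma)$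 (possibly depending on $j$) in which $j$ is proper. Let $\operatorname{In}(j)$ (resp., $\operatorname{Out}(j)$) be the set of vertices $i$ with an arrow $i\to j$ (resp., $j\to i$) in $Q$. If $j$ is proper in $(Q,\sigma)$, the proper mutation $\mu_j(Q,\sigma)$ is the quiver $\mu_j(Q)$ with the cyclic ordering obtained from $\sigma$ by keeping the placement of all vertices other than $j$ and moving $j$ clockwise past all the vertices in $\operatorname{Out}(j)$ (each exactly once) without passing any vertex in $\operatorname{In}(j)$ (well defined up to wiggles; for a sink or source $j$ the cyclic ordering does not change, up to wiggles). *)

theory Defs
  imports Main
begin

section \<open>Quivers\<close>

text \<open>
  Arrows with the same endpoints are interchangeable, so a quiver is given by its vertex set
  together with the number \<open>arr Q i j\<close> of arrows from \<open>i\<close> to \<open>j\<close>.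
\<close>

record 'a quiver =
  verts :: "'a set"
  arr :: "'a \<Rightarrow> 'a \<Rightarrow> nat"

definition is_quiver :: "'a quiver \<Rightarrow> bool" where
  "is_quiver Q \<longleftrightarrow>
     finite (verts Q) \<and>
     (\<forall>i j. arr Q i j > 0 \<longrightarrow> i \<in> verts Q \<and> j \<in> verts Q) \<and>
     (\<forall>i. arr Q i i = 0) \<and>
     (\<forall>i j. \<not> (arr Q i j > 0 \<and> arr Q j i > 0))"

definition In_set :: "'a quiver \<Rightarrow> 'a \<Rightarrow> 'a set" where
  "In_set Q j = {i \<in> verts Q. arr Q i j > 0}"

definition Out_set :: "'a quiver \<Rightarrow> 'a \<Rightarrow> 'a set" where
  "Out_set Q j = {i \<in> verts Q. arr Q j i > 0}"

definition adjacent :: "'a quiver \<Rightarrow> 'a \<Rightarrow> 'a \<Rightarrow> bool" where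
  "adjacent Q i j \<longleftrightarrow> arr Q i j > 0 \<or> arr Q j i > 0"

definition complete_quiver :: "'a quiver \<Rightarrow> bool" where
  "complete_quiver Q \<longleftrightarrow> (\<forall>i\<in>verts Q. \<forall>j\<in>verts Q. i \<noteq> j \<longrightarrow> adjacent Q i j)"

definition is_source :: "'a quiver \<Rightarrow> 'a \<Rightarrow> bool" where
  "is_source Q j \<longleftrightarrow> j \<in> verts Q \<and> In_set Q j = {}"

definition is_sink :: "'a quiver \<Rightarrow> 'a \<Rightarrow> bool" where
  "is_sink Q j \<longleftrightarrow> j \<in> verts Q \<and> Out_set Q j = {}"

definition full_subquiver :: "'a quiver \<Rightarrow> 'a set \<Rightarrow> 'a quiver" where
  "full_subquiver Q W =
     \<lparr>verts = W, arr = (\<lambda>i j. if i \<in> W \<and> j \<in> W then arr Q i j else 0)\<rparr>"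

definition vortex :: "'a quiver \<Rightarrow> bool" where
  "vortex Q \<longleftrightarrow>
     is_quiver Q \<and> card (verts Q) = 4 \<and> complete_quiver Q \<and>
     (\<exists>s\<in>verts Q. (is_source Q s \<or> is_sink Q s) \<and>
        (\<exists>x y z. verts Q - {s} = {x, y, z} \<and> arr Q x y > 0 \<and> arr Q y z > 0 \<and> arr Q z x > 0))"

definition vortex_free :: "'a quiver \<Rightarrow> bool" where
  "vortex_free Q \<longleftrightarrow> (\<forall>W. W \<subseteq> verts Q \<and> card W = 4 \<longrightarrow> \<not> vortex (full_subquiver Q W))"

text \<open>
  The three steps of the mutation at \<open>j\<close>. A pair of consecutive arrows
  \<open>i \<rightarrow> j \<rightarrow> k\<close> can be chosen in \<open>arr Q i j * arr Q j k\<close> ways; removing oriented 2-cycles as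
  long as there are any leaves the truncated difference of the two opposite multiplicities.
\<close>

definition add_composites :: "'a \<Rightarrow> 'a quiver \<Rightarrow> 'a quiver" where
  "add_composites j Q = Q\<lparr>arr := (\<lambda>i k. arr Q i k + arr Q i j * arr Q j k)\<rparr>"

definition reverse_at :: "'a \<Rightarrow> 'a quiver \<Rightarrow> 'a quiver" where
  "reverse_at j Q = Q\<lparr>arr := (\<lambda>i k. if i = j \<or> k = j then arr Q k i else arr Q i k)\<rparr>"

definition cancel_two_cycles :: "'a quiver \<Rightarrow> 'a quiver" where
  "cancel_two_cycles Q = Q\<lparr>arr := (\<lambda>i k. arr Q i k - arr Q k i)\<rparr>"

definition mutation :: "'a \<Rightarrow> 'a quiver \<Rightarrow> 'a quiver" where
  "mutation j Q = cancel_two_cycles (reverse_at j (add_composites j Q))"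


section \<open>Cyclically ordered quivers\<close>

text \<open>A linear ordering up to cyclic shifts; list order is the clockwise direction.\<close>

definition cyc :: "'a list \<Rightarrow> 'a list set" where
  "cyc vs = {rotate n vs | n. True}"

definition cyclic_ordering :: "'a set \<Rightarrow> 'a list set \<Rightarrow> bool" where
  "cyclic_ordering V \<sigma> \<longleftrightarrow> (\<exists>vs. distinct vs \<and> set vs = V \<and> \<sigma> = cyc vs)"

type_synonym 'a coq = "'a quiver \<times> 'a list set"

definition is_coq :: "'a coq \<Rightarrow> bool" where
  "is_coq R \<longleftrightarrow> is_quiver (fst R) \<and> cyclic_ordering (verts (fst R)) (snd R)"

definition wiggle :: "'a coq \<Rightarrow> 'a coq \<Rightarrow> bool" where
  "wiggle R R' \<longleftrightarrow>
     is_coq R \<and> fst R' = fst R \<and>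
     (\<exists>u v vs. snd R = cyc (u # v # vs) \<and> snd R' = cyc (v # u # vs) \<and> \<not> adjacent (fst R) u v)"

definition wiggle_equivalent :: "'a coq \<Rightarrow> 'a coq \<Rightarrow> bool" where
  "wiggle_equivalent = equivclp wiggle"

definition right_turn :: "'a list set \<Rightarrow> 'a \<Rightarrow> 'a \<Rightarrow> 'a \<Rightarrow> bool" where
  "right_turn \<sigma> i j k \<longleftrightarrow>
     (\<exists>ws xs ys zs. \<sigma> = cyc (ws @ [i] @ xs @ [j] @ ys @ [k] @ zs))"

definition proper_vertex :: "'a coq \<Rightarrow> 'a \<Rightarrow> bool" where
  "proper_vertex R j \<longleftrightarrow>
     (\<forall>i k. arr (fst R) i j > 0 \<and> arr (fst R) j k > 0 \<longrightarrow> right_turn (snd R) i j k)"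

definition proper_coq :: "'a coq \<Rightarrow> bool" where
  "proper_coq R \<longleftrightarrow>
     is_coq R \<and> (\<forall>j\<in>verts (fst R). \<exists>R'. wiggle_equivalent R R' \<and> proper_vertex R' j)"

text \<open>
  \<open>proper_mutation j R R'\<close>: the result \<open>R'\<close> is determined only up to wiggles, since the vertices
  not adjacent to \<open>j\<close> may or may not be passed; \<open>xs\<close> is the list of vertices that \<open>j\<close> passes
  while moving clockwise.
\<close>

definition proper_mutation :: "'a \<Rightarrow> 'a coq \<Rightarrow> 'a coq \<Rightarrow> bool" where
  "proper_mutation j R R' \<longleftrightarrow>
     is_coq R \<and> j \<in> verts (fst R) \<and> proper_vertex R j \<and>
     fst R' = mutation j (fst R) \<and>
     (\<exists>xs ys. snd R = cyc (j # xs @ ys) \<and> snd R' = cyc (xs @ j # ys) \<and>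
        Out_set (fst R) j \<subseteq> set xs \<and> In_set (fst R) j \<inter> set xs = {})"



section \<open>Existence of proper mutations in the complete case\<close>

lemma cyc_refl: "vs \<in> cyc vs"
proof -
  have "vs = rotate 0 vs" by simp
  then show ?thesis unfolding cyc_def by blast
qed

lemma cyc_rotate: "cyc (rotate m vs) = cyc vs"
proof (cases "vs = []")
  case True
  then show ?thesis by simp
next
  case False
  show ?thesis
  proof
    show "cyc (rotate m vs) \<subseteq> cyc vs"
      by (auto simp: cyc_def rotate_rotate)
    show "cyc vs \<subseteq> cyc (rotate m vs)"
    proof
      fix ws assume "ws \<in> cyc vs"
      then obtain n where n: "ws = rotate n vs" by (auto simp: cyc_def)
      obtain l where l: "length vs = Suc l" using False by (cases vs) auto
      have e: "n + m * l + m = n + m * length vs" by (simp add: l)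
      have "rotate (n + m * l) (rotate m vs) = rotate (n + m * length vs) vs"
        by (simp only: rotate_rotate e)
      also have "\<dots> = rotate ((n + m * length vs) mod length vs) vs"
        by (rule rotate_conv_mod)
      also have "\<dots> = ws"
        using n rotate_conv_mod[of n vs] by simp
      finally show "ws \<in> cyc (rotate m vs)"
        unfolding cyc_def by blast
    qed
  qed
qed

lemma cyc_append: "cyc (xs @ ys) = cyc (ys @ xs)"
  using cyc_rotate[of "length xs" "xs @ ys"] by (simp add: rotate_append)

lemma cyc_eqD: "cyc vs = cyc ws \<Longrightarrow> \<exists>n. ws = rotate n vs"
  using cyc_refl[of ws] by (auto simp: cyc_def)

lemma cyc_eq_set: "cyc vs = cyc ws \<Longrightarrow> set vs = set ws \<and> distinct vs = distinct ws"
  using cyc_eqD[of vs ws] by auto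

lemma cyc_Cons_eq:
  assumes "cyc (j # xs) = cyc (j # ys)" and "distinct (j # xs)"
  shows "xs = ys"
proof -
  obtain n where n: "j # ys = rotate n (j # xs)" using cyc_eqD[OF assms(1)] by blast
  define m where "m = n mod length (j # xs)"
  have m: "j # ys = rotate m (j # xs)" "m < length (j # xs)"
    using n rotate_conv_mod[of n "j # xs"] by (auto simp: m_def)
  have "(j # xs) ! m = hd (rotate m (j # xs))"
    using m(2) by (simp add: hd_rotate_conv_nth)
  also have "\<dots> = (j # xs) ! 0" using m(1) by (metis list.sel(1) nth_Cons_0)
  finally have "m = 0"
    using assms(2) m(2) nth_eq_iff_index_eq[of "j # xs" m 0] by simp
  with m(1) show ?thesis by simp
qed

lemma cyclic_ordering_starting_at:
  assumes "is_coq (Q, \<sigma>)" and "j \<in> verts Q"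
  obtains zs where "\<sigma> = cyc (j # zs)" "distinct (j # zs)" "set (j # zs) = verts Q"
proof -
  obtain vs where vs: "distinct vs" "set vs = verts Q" "\<sigma> = cyc vs"
    using assms(1) by (auto simp: is_coq_def cyclic_ordering_def)
  then obtain as bs where "vs = as @ j # bs"
    using assms(2) split_list by metis
  then show thesis
    using that[of "bs @ as"] vs cyc_append[of as "j # bs"] by auto
qed

lemma wiggle_not_complete:
  assumes "wiggle R R'" shows "\<not> complete_quiver (fst R)"
proof
  assume c: "complete_quiver (fst R)"
  from assms obtain u v vs ws where
    "snd R = cyc (u # v # vs)" "\<not> adjacent (fst R) u v"
    "snd R = cyc ws" "distinct ws" "set ws = verts (fst R)"
    by (auto simp: wiggle_def is_coq_def cyclic_ordering_def)
  with cyc_eq_set[of "u # v # vs" ws] have "u \<noteq> v" "u \<in> verts (fst R)" "v \<in> verts (fst R)"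
    "\<not> adjacent (fst R) u v" by auto
  with c show False by (simp add: complete_quiver_def)
qed

lemma wiggle_equivalent_complete:
  assumes "wiggle_equivalent R R'" and "complete_quiver (fst R)"
  shows "R' = R"
  using assms(1) unfolding wiggle_equivalent_def
proof (induction rule: equivclp_induct)
  case base
  show ?case by simp
next
  case (step y z)
  then have "fst z = fst y" by (auto simp: wiggle_def)
  with step assms(2) wiggle_not_complete show ?case by metis
qed

lemma complete_proper_vertex:
  assumes "proper_coq (Q, \<sigma>)" "complete_quiver Q" "j \<in> verts Q"
  shows "proper_vertex (Q, \<sigma>) j"
  using assms wiggle_equivalent_complete[of "(Q, \<sigma>)"]
  by (fastforce simp: proper_coq_def)

lemma proper_mutation_exists:
  assumes proper: "proper_vertex (Q, \<sigma>) j" and coq: "is_coq (Q, \<sigma>)" and j: "j \<in> verts Q"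
  shows "\<exists>R'. proper_mutation j (Q, \<sigma>) R'"
proof -
  obtain zs where zs: "\<sigma> = cyc (j # zs)" "distinct (j # zs)" "set (j # zs) = verts Q"
    using cyclic_ordering_starting_at[OF coq j] .
  define P where "P = (\<lambda>i. arr Q i j = 0)"
  have dj: "arr Q j j = 0" using coq by (auto simp: is_coq_def is_quiver_def)
  have zs_split: "zs = takeWhile P zs @ dropWhile P zs" by simp
  have "k \<in> set (takeWhile P zs)" if k: "k \<in> verts Q" "arr Q j k > 0" for k
  proof (rule ccontr)
    assume n: "k \<notin> set (takeWhile P zs)"
    have "k \<in> set zs" using k dj zs(3) by (cases "k = j") auto
    with n have kd: "k \<in> set (dropWhile P zs)"
      by (metis UnE set_append takeWhile_dropWhile_id)
    then obtain i ds where d: "dropWhile P zs = i # ds"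
      by (cases "dropWhile P zs") auto
    then have ni: "arr Q i j > 0"
      using hd_dropWhile[of P zs] by (auto simp: P_def)
    have "k \<noteq> i" using ni k(2) coq unfolding is_coq_def is_quiver_def by (metis fst_conv)
    then have "k \<in> set ds" using kd d by simp
    then obtain as bs where ds: "ds = as @ k # bs" using split_list by metis
    from proper ni k(2) have "right_turn \<sigma> i j k" by (auto simp: proper_vertex_def)
    then obtain ws xs ys us where "\<sigma> = cyc (ws @ [i] @ xs @ [j] @ ys @ [k] @ us)"
      by (auto simp: right_turn_def)
    then have "cyc (j # zs) = cyc (j # ys @ [k] @ us @ ws @ [i] @ xs)"
      using zs(1) cyc_append[of "ws @ [i] @ xs" "[j] @ ys @ [k] @ us"] by simp
    from cyc_Cons_eq[OF this zs(2)]
    have eq: "zs = (ys @ [k] @ us @ ws) @ i # xs" by simp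
    have zs': "zs = takeWhile P zs @ i # as @ k # bs"
      using zs_split unfolding d ds .
    have "distinct zs" using zs(2) by simp
    then have "distinct (takeWhile P zs @ i # as @ k # bs)"
      using zs' by (rule subst[rotated])
    then have "i \<notin> set (takeWhile P zs)" "i \<notin> set (as @ k # bs)" by auto
    moreover have "takeWhile P zs @ i # as @ k # bs = (ys @ [k] @ us @ ws) @ i # xs"
      using zs' eq by (rule subst)
    ultimately have "takeWhile P zs = ys @ [k] @ us @ ws"
      using append_Cons_eq_iff by metis
    then have "k \<in> set (takeWhile P zs)" by (simp only: set_append) simp
    then show False using n by contradiction
  qed
  then have O: "Out_set Q j \<subseteq> set (takeWhile P zs)" by (auto simp: Out_set_def)
  have I: "In_set Q j \<inter> set (takeWhile P zs) = {}"
    by (auto simp: In_set_def P_def dest: set_takeWhileD)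
  have "proper_mutation j (Q, \<sigma>)
      (mutation j Q, cyc (takeWhile P zs @ j # dropWhile P zs))"
    unfolding proper_mutation_def
    using coq j proper O I zs(1) zs_split by (metis fst_conv snd_conv)
  then show ?thesis ..
qed

end

theory Submission
  imports Defs
begin

text \<open>
  Read \<open>\<sigma>\<close> clockwise from \<open>b\<close>. Since \<open>b\<close> is proper, \<open>\<sigma>\<close> is \<open>b\<close>, followed by the vertices of
  \<open>Out b\<close>, followed by those of \<open>In b\<close>, and \<open>\<sigma>'\<close> is \<open>Out b\<close>, \<open>b\<close>, \<open>In b\<close>. Since the other vertices are
  proper, the arrows inside \<open>Out b\<close> and inside \<open>In b\<close> all point clockwise, and the mutation keeps
  them. In \<open>Q'\<close> the only unknown arrows are those between \<open>Out b\<close> and \<open>In b\<close>, and a left turn at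
  \<open>o \<in> Out b\<close> can only be of the form \<open>i \<rightarrow> o \<rightarrow> k\<close> with \<open>i\<close>, \<open>k\<close> in this order in \<open>In b\<close>; then
  \<open>o \<rightarrow> b \<rightarrow> i \<rightarrow> o\<close> is an oriented cycle and \<open>k\<close> is a sink, which is a vortex. Dually, a left turn
  at a vertex of \<open>In b\<close> gives a vortex with a source. So all vertices of \<open>Q'\<close> are proper without any
  wiggles, even though \<open>Q'\<close> need not be complete.
\<close>

fun before :: "'a list \<Rightarrow> 'a \<Rightarrow> 'a \<Rightarrow> bool" where
  "before [] x y \<longleftrightarrow> False"
| "before (z # zs) x y \<longleftrightarrow> x = z \<and> y \<in> set zs \<or> before zs x y"

lemma before_append:
  "before (xs @ ys) x y \<longleftrightarrow> before xs x y \<or> before ys x y \<or> x \<in> set xs \<and> y \<in> set ys"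
  by (induction xs) auto

lemma before_in_set: "before xs x y \<Longrightarrow> x \<in> set xs \<and> y \<in> set xs"
  by (induction xs) auto

lemma before_total: "x \<in> set xs \<Longrightarrow> y \<in> set xs \<Longrightarrow> x \<noteq> y \<Longrightarrow> before xs x y \<or> before xs y x"
  by (induction xs) auto

lemma before_asym: "distinct xs \<Longrightarrow> before xs x y \<Longrightarrow> \<not> before xs y x"
  by (induction xs) (auto dest: before_in_set)

lemma before_split: "before xs x y \<Longrightarrow> \<exists>as bs cs. xs = as @ x # bs @ y # cs"
proof (induction xs)
  case (Cons z zs)
  show ?case
  proof (cases "x = z \<and> y \<in> set zs")
    case True
    then show ?thesis by (metis append_Nil split_list)
  next
    case False
    with Cons obtain as bs cs where "zs = as @ x # bs @ y # cs" by auto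
    then have "z # zs = (z # as) @ x # bs @ y # cs" by simp
    then show ?thesis by blast
  qed
qed simp

lemma before_before_split:
  assumes "distinct vs" "before vs x y" "before vs y z"
  shows "\<exists>as bs cs ds. vs = as @ x # bs @ y # cs @ z # ds"
proof -
  obtain as bs cs where vs: "vs = as @ x # bs @ y # cs" using before_split assms(2) by metis
  have "z \<in> set cs"
    using assms(1,3) before_in_set[of as y z] before_in_set[of bs y z]
    unfolding vs by (auto simp: before_append dest: before_in_set)
  then obtain ds es where "cs = ds @ z # es" using split_list by metis
  with vs show ?thesis by auto
qed

text \<open>Each disjunct is one place where the circle can be cut open, so for a distinct list the
  condition does not depend on the chosen rotation.\<close>

definition cyclic_before :: "'a list \<Rightarrow> 'a \<Rightarrow> 'a \<Rightarrow> 'a \<Rightarrow> bool" where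
  "cyclic_before vs i j k \<longleftrightarrow>
     before vs i j \<and> before vs j k \<or> before vs j k \<and> before vs k i \<or> before vs k i \<and> before vs i j"

lemma cyclic_before_rotate1:
  "distinct vs \<Longrightarrow> cyclic_before (rotate1 vs) i j k \<longleftrightarrow> cyclic_before vs i j k"
  by (cases vs) (auto simp: cyclic_before_def before_append dest: before_in_set)

lemma cyclic_before_rotate:
  "distinct vs \<Longrightarrow> cyclic_before (rotate n vs) i j k \<longleftrightarrow> cyclic_before vs i j k"
  by (induction n) (simp_all add: cyclic_before_rotate1)

text \<open>Trades the existential over representatives for a condition on one fixed list.
  Backwards, a rotation moves the cut until \<open>i\<close>, \<open>j\<close>, \<open>k\<close>
  appear in this order.\<close>

lemma right_turn_iff_cyclic_before:
  assumes "distinct vs"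
  shows "right_turn (cyc vs) i j k \<longleftrightarrow> cyclic_before vs i j k"
proof
  assume "right_turn (cyc vs) i j k"
  then obtain ws xs ys zs where "cyc vs = cyc (ws @ [i] @ xs @ [j] @ ys @ [k] @ zs)"
    by (auto simp: right_turn_def)
  then obtain n where n: "ws @ [i] @ xs @ [j] @ ys @ [k] @ zs = rotate n vs"
    using cyc_eqD by metis
  have "cyclic_before (ws @ [i] @ xs @ [j] @ ys @ [k] @ zs) i j k"
    by (simp add: cyclic_before_def before_append)
  then show "cyclic_before vs i j k"
    unfolding n cyclic_before_rotate[OF assms] .
next
  assume "cyclic_before vs i j k"
  then consider "before vs i j" "before vs j k" | "before vs j k" "before vs k i"
    | "before vs k i" "before vs i j"
    by (auto simp: cyclic_before_def)
  then show "right_turn (cyc vs) i j k"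
  proof cases
    case 1
    then obtain as bs cs ds where "vs = as @ i # bs @ j # cs @ k # ds"
      using before_before_split[OF assms] by metis
    then have "cyc vs = cyc (as @ [i] @ bs @ [j] @ cs @ [k] @ ds)" by simp
    then show ?thesis unfolding right_turn_def by blast
  next
    case 2
    then obtain as bs cs ds where "vs = as @ j # bs @ k # cs @ i # ds"
      using before_before_split[OF assms] by metis
    then have "cyc vs = cyc ([] @ [i] @ (ds @ as) @ [j] @ bs @ [k] @ cs)"
      using cyc_append[of "as @ j # bs @ k # cs" "i # ds"] by simp
    then show ?thesis unfolding right_turn_def by blast
  next
    case 3
    then obtain as bs cs ds where "vs = as @ k # bs @ i # cs @ j # ds"
      using before_before_split[OF assms] by metis
    then have "cyc vs = cyc (bs @ [i] @ cs @ [j] @ (ds @ as) @ [k] @ [])"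
      using cyc_append[of "as @ [k]" "bs @ i # cs @ j # ds"] by simp
    then show ?thesis unfolding right_turn_def by blast
  qed
qed

lemma verts_mutation [simp]: "verts (mutation j Q) = verts Q"
  by (simp add: mutation_def cancel_two_cycles_def reverse_at_def add_composites_def)

lemma arr_mutation:
  "arr (mutation j Q) i k =
     (if i = j \<or> k = j
      then (arr Q k i + arr Q k j * arr Q j i) - (arr Q i k + arr Q i j * arr Q j k)
      else (arr Q i k + arr Q i j * arr Q j k) - (arr Q k i + arr Q k j * arr Q j i))"
  by (auto simp: mutation_def cancel_two_cycles_def reverse_at_def add_composites_def)

text \<open>Opposite multiplicities are opposite truncated differences of the same two numbers, so
  at most one of them is positive.\<close>

lemma is_quiver_mutation:
  assumes "is_quiver Q"
  shows "is_quiver (mutation j Q)"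
proof -
  have "i \<in> verts Q \<and> k \<in> verts Q" if "arr (mutation j Q) i k > 0" for i k
  proof -
    from that have "arr Q i k > 0 \<or> arr Q k i > 0 \<or> arr Q i j * arr Q j k > 0
        \<or> arr Q k j * arr Q j i > 0"
      by (auto simp: arr_mutation split: if_splits)
    with assms show ?thesis unfolding is_quiver_def by (metis nat_0_less_mult_iff)
  qed
  with assms show ?thesis
    by (auto simp: is_quiver_def arr_mutation split: if_splits)
qed

text \<open>The given arrows join all six pairs among \<open>s\<close>, \<open>x\<close>,
  \<open>y\<close>, \<open>z\<close>. Hence the four vertices are distinct, as there are no loops,
  and they span a complete subquiver.\<close>

lemma vortex_free_no_vortex:
  assumes vf: "vortex_free Q" and q: "is_quiver Q"
    and cycle: "arr Q x y > 0" "arr Q y z > 0" "arr Q z x > 0"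
    and s: "(arr Q s x > 0 \<and> arr Q s y > 0 \<and> arr Q s z > 0)
      \<or> (arr Q x s > 0 \<and> arr Q y s > 0 \<and> arr Q z s > 0)"
  shows False
proof -
  have anti: "arr Q v u = 0" if "arr Q u v > 0" for u v
    using q that unfolding is_quiver_def by (metis neq0_conv)
  have irr: "arr Q u u = 0" for u
    using q unfolding is_quiver_def by auto
  have dist: "x \<noteq> y" "y \<noteq> z" "z \<noteq> x" "s \<noteq> x" "s \<noteq> y" "s \<noteq> z"
    using cycle s irr by auto
  let ?W = "{s, x, y, z}"
  let ?F = "full_subquiver Q ?W"
  have sub: "?W \<subseteq> verts Q"
    using q cycle s unfolding is_quiver_def by blast
  have card: "card ?W = 4" using dist by auto
  have "is_quiver ?F"
    using anti irr by (auto simp: is_quiver_def full_subquiver_def)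
  moreover have "complete_quiver ?F"
    using cycle s by (auto simp: complete_quiver_def full_subquiver_def adjacent_def)
  moreover have "is_source ?F s \<or> is_sink ?F s"
    using s anti irr
    by (auto simp: is_source_def is_sink_def In_set_def Out_set_def full_subquiver_def)
  moreover have "verts ?F - {s} = {x, y, z}" using dist by (auto simp: full_subquiver_def)
  moreover have "arr ?F x y > 0" "arr ?F y z > 0" "arr ?F z x > 0" "s \<in> verts ?F" "verts ?F = ?W"
    using cycle by (auto simp: full_subquiver_def)
  ultimately have "vortex ?F" unfolding vortex_def using card by metis
  with vf sub card show False unfolding vortex_free_def by blast
qed

theorem proposition13p11:
  fixes Q Q' :: "'a quiver" and \<sigma> \<sigma>' :: "'a list set" and b :: 'a
  assumes "proper_coq (Q, \<sigma>)"
    and "complete_quiver Q"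
    and "b \<in> verts Q"
    and "proper_mutation b (Q, \<sigma>) (Q', \<sigma>')"
    and "vortex_free Q'"
  shows "proper_coq (Q', \<sigma>')"
proof -
  have q: "is_quiver Q" and ord: "cyclic_ordering (verts Q) \<sigma>"
    using assms(1) by (auto simp: proper_coq_def is_coq_def)
  have Q': "Q' = mutation b Q" using assms(4) by (simp add: proper_mutation_def)
  obtain xs ys where \<sigma>: "\<sigma> = cyc (b # xs @ ys)" and \<sigma>': "\<sigma>' = cyc (xs @ b # ys)"
    and out: "Out_set Q b \<subseteq> set xs" and "in": "In_set Q b \<inter> set xs = {}"
    using assms(4) by (auto simp: proper_mutation_def)
  have d: "distinct (b # xs @ ys)" and V: "verts Q = set (b # xs @ ys)"
    using ord \<sigma> cyc_eq_set unfolding cyclic_ordering_def by metis+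
  have d': "distinct (xs @ b # ys)" and V': "verts Q' = set (xs @ b # ys)"
    using d V by (auto simp: Q')
  have q': "is_quiver Q'" using is_quiver_mutation[OF q] by (simp add: Q')
  have coq': "is_coq (Q', \<sigma>')"
    unfolding is_coq_def cyclic_ordering_def fst_conv snd_conv using q' d' V' \<sigma>' by blast
  have anti: "arr Q v u = 0" if "arr Q u v > 0" for u v
    using q that unfolding is_quiver_def by (metis neq0_conv)
  have anti': "arr Q' v u = 0" if "arr Q' u v > 0" for u v
    using q' that unfolding is_quiver_def by (metis neq0_conv)
  have irr: "arr Q u u = 0" for u
    using q unfolding is_quiver_def by auto
  have adj: "arr Q u v > 0 \<or> arr Q v u > 0" if "u \<in> verts Q" "v \<in> verts Q" "u \<noteq> v" for u v
    using assms(2) that by (auto simp: complete_quiver_def adjacent_def)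
  \<comment> \<open>A complete quiver admits no wiggles, so every vertex is already proper for
    \<open>\<sigma>\<close> itself.\<close>
  have turn: "cyclic_before (b # xs @ ys) i j k" if "arr Q i j > 0" "arr Q j k > 0" for i j k
  proof -
    have "j \<in> verts Q" using q that unfolding is_quiver_def by blast
    from complete_proper_vertex[OF assms(1,2) this] that
    show ?thesis using right_turn_iff_cyclic_before[OF d] \<sigma> by (auto simp: proper_vertex_def)
  qed
  \<comment> \<open>Completeness leaves no vertex that \<open>b\<close> may pass or not at will:
    \<open>xs\<close> lists exactly the out-neighbours and \<open>ys\<close> exactly the
    in-neighbours.\<close>
  have bxs: "arr Q b x > 0" if "x \<in> set xs" for x
    using that "in" adj[of b x] V d by (auto simp: In_set_def)
  have ysb: "arr Q y b > 0" if "y \<in> set ys" for y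
    using that out adj[of b y] V d by (auto simp: Out_set_def)
  have asym: "\<not> before xs v u" "u \<noteq> v" if "before xs u v" for u v
    using before_asym that d by fastforce+
  have asym_ys: "\<not> before ys v u" "u \<noteq> v" if "before ys u v" for u v
    using before_asym that d by fastforce+
  have xs_Q: "arr Q u v > 0" if uv: "before xs u v" for u v
  proof (rule ccontr)
    assume "\<not> arr Q u v > 0"
    with adj[of u v] V before_in_set[OF uv] asym[OF uv] have "arr Q v u > 0" by auto
    \<comment> \<open>The path from \<open>b\<close> via \<open>v\<close> to \<open>u\<close> must
      turn right at \<open>v\<close>, but clockwise from \<open>b\<close> the vertex
      \<open>u\<close> comes before \<open>v\<close>.\<close>
    with turn[of b v u] bxs[of v] before_in_set[OF uv] asym[OF uv] d uv
    show False by (auto simp: cyclic_before_def before_append dest: before_in_set)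
  qed
  have ys_Q: "arr Q u v > 0" if uv: "before ys u v" for u v
  proof (rule ccontr)
    assume "\<not> arr Q u v > 0"
    with adj[of u v] V before_in_set[OF uv] asym_ys[OF uv] have "arr Q v u > 0" by auto
    \<comment> \<open>Dually, the path from \<open>v\<close> via \<open>u\<close> to
      \<open>b\<close> fails to turn right at \<open>u\<close>.\<close>
    with turn[of v u b] ysb[of u] before_in_set[OF uv] asym_ys[OF uv] d uv
    show False by (auto simp: cyclic_before_def before_append dest: before_in_set)
  qed
  have xsb': "arr Q' x b > 0" if "x \<in> set xs" for x
    using bxs[OF that] anti[OF bxs[OF that]] by (simp add: Q' arr_mutation irr)
  have bys': "arr Q' b y > 0" if "y \<in> set ys" for y
    using ysb[OF that] anti[OF ysb[OF that]] by (simp add: Q' arr_mutation irr)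
  \<comment> \<open>Both vertices lie in \<open>Out_set Q b\<close>, so no path through
    \<open>b\<close> joins them and mutation adds or cancels nothing.\<close>
  have xs_Q': "arr Q' u v > 0" if uv: "before xs u v" for u v
    using xs_Q[OF uv] anti[OF xs_Q[OF uv]] before_in_set[OF uv] anti[OF bxs[of u]] anti[OF bxs[of v]] d
    by (auto simp: Q' arr_mutation)
  have ys_Q': "arr Q' u v > 0" if uv: "before ys u v" for u v
    using ys_Q[OF uv] anti[OF ys_Q[OF uv]] before_in_set[OF uv] anti[OF ysb[of u]] anti[OF ysb[of v]] d
    by (auto simp: Q' arr_mutation)
  have irr': "arr Q' u u = 0" for u
    using q' unfolding is_quiver_def by auto
  have xs_iff: "arr Q' u v > 0 \<longleftrightarrow> before xs u v" if "u \<in> set xs" "v \<in> set xs" for u v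
    using before_total[OF that] xs_Q'[of u v] anti'[OF xs_Q'[of v u]] irr' by (cases "u = v") (auto dest: asym)
  have ys_iff: "arr Q' u v > 0 \<longleftrightarrow> before ys u v" if "u \<in> set ys" "v \<in> set ys" for u v
    using before_total[OF that] ys_Q'[of u v] anti'[OF ys_Q'[of v u]] irr' by (cases "u = v") (auto dest: asym_ys)
  have "proper_vertex (Q', \<sigma>') j" for j
    unfolding proper_vertex_def fst_conv snd_conv
  proof (intro allI impI, elim conjE)
    fix i k assume ij: "arr Q' i j > 0" and jk: "arr Q' j k > 0"
    have in_V: "i \<in> set (xs @ b # ys)" "j \<in> set (xs @ b # ys)" "k \<in> set (xs @ b # ys)"
      using ij jk q' V' unfolding is_quiver_def by metis+
    have ik: "i \<noteq> k" using ij jk anti' by fastforce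
    have ne: "\<not> (i \<in> set ys \<and> j = b)" "\<not> (i = b \<and> j \<in> set xs)" "\<not> (k \<in> set xs \<and> j = b)"
      "\<not> (k = b \<and> j \<in> set ys)" "i \<noteq> j" "j \<noteq> k"
      using ij jk anti'[OF xsb'] anti'[OF bys'] irr' by auto
    have ys_case: "before ys k i" if "j \<in> set xs" "i \<in> set ys" "k \<in> set ys"
    proof (rule ccontr)
      assume "\<not> before ys k i"
      with before_total[OF that(2,3)] ik have "before ys i k" by auto
      from vortex_free_no_vortex[OF assms(5) q' xsb'[OF that(1)] bys'[OF that(2)] ij, of k]
      show False using jk bys'[OF that(3)] ys_Q'[OF \<open>before ys i k\<close>] by auto
    qed
    have xs_case: "before xs k i" if "j \<in> set ys" "i \<in> set xs" "k \<in> set xs"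
    proof (rule ccontr)
      assume "\<not> before xs k i"
      with before_total[OF that(2,3)] ik have "before xs i k" by auto
      \<comment> \<open>The cycle is now \<open>j\<close>, \<open>k\<close>, \<open>b\<close>, and
        \<open>i\<close> is the source.\<close>
      from vortex_free_no_vortex[OF assms(5) q' jk xsb'[OF that(3)] bys'[OF that(1)], of i]
      show False using ij xsb'[OF that(2)] xs_Q'[OF \<open>before xs i k\<close>] by auto
    qed
    have "cyclic_before (xs @ b # ys) i j k"
    proof -
      consider "j = b" | "j \<in> set xs" | "j \<in> set ys" using in_V by auto
      then show ?thesis
      proof cases
        case 1
        then have "i \<in> set xs" "k \<in> set ys" using in_V ne by auto
        with 1 show ?thesis by (simp add: cyclic_before_def before_append)
      next
        case 2
        \<comment> \<open>Every combination of these alternatives is clockwise by position alone,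
          except \<open>i\<close> and \<open>k\<close> both in \<open>ys\<close>, which
          \<open>ys_case\<close> settles. The next case is dual.\<close>
        then have "i \<in> set ys \<or> before xs i j" "k = b \<or> k \<in> set ys \<or> before xs j k"
          using in_V ne xs_iff[of i j] xs_iff[of j k] ij jk by auto
        with 2 ys_case show ?thesis
          unfolding cyclic_before_def before_append before.simps set_simps
          by (metis before_in_set insertCI)
      next
        case 3
        then have "i = b \<or> i \<in> set xs \<or> before ys i j" "k \<in> set xs \<or> before ys j k"
          using in_V ne ys_iff[of i j] ys_iff[of j k] ij jk by auto
        with 3 xs_case show ?thesis
          unfolding cyclic_before_def before_append before.simps set_simps
          by (metis before_in_set insertCI)
      qed
    qed
    then show "right_turn \<sigma>' i j k"
      using right_turn_iff_cyclic_before[OF d'] \<sigma>' by simp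
  qed
  then show ?thesis
    unfolding proper_coq_def wiggle_equivalent_def using coq' equivclp_refl by metis
qed

end
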